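(* Let $\lambda>-\frac12$ and $\lambda\ne0$. Then $\mathrm{BMO}_{\Delta_\lambda}(\mathbb{R}_+)$ coincides with $\mathrm{BMO}_\lambda(\mathbb{R}_+)$ and they have equivalent norms.
   Context: $\mathbb{R}_+=(0,\infty)$; intervals $B\subset\mathbb{R}_+$ are intervals $(a,b)$ with $0\le a<b<\infty$; $dm_\lambda(x)=x^{2\lambda}dx$; $d\nu_\lambda(x)=x^{2\lambda+1}dx$; $m_\lambda(B),\nu_\lambda(B)$ are the corresponding measures of $B$. $\mathrm{BMO}_\lambda(\mathbb{R}_+)=\{f\in L^1_{loc}(\mathbb{R}_+,d\nu_\lambda):\mathcal{M}^\#_\lambda f\in L^\infty\}$ with $\|f\|_{\mathrm{BMO}_\lambda}=\|\mathcal{M}^\#_\lambda f\|_{L^\infty}$, where $\mathcal{M}^\#_\lambda f(x)=\sup_{B\ni x,\,B\subset\mathbb{R}_+}\frac1{\nu_\lambda(B)}\int_B|f(t)-f_{B,\lambda}|d\nu_\lambda(t)$ and $f_{B,\lambda}=\frac1{\nu_\lambda(B)}\int_Bf\,d\nu_\lambda$. $\mathrm{BMO}_{\Delta_\lambda}(\mathbb{R}_+)=\{f\in L^1_{loc}(\mathbb{R}_+,dm_\lambda):\|f\|_{\mathrm{BMO}_{\Delta_\lambda}(\mathbb{R}_+)}<\infty\}$ with $\|f\|_{\mathrm{BMO}_{\Delta_\lambda}(\mathbb{R}_+)}=\sup_{B\subset\mathbb{R}_+}\frac1{m_\lambda(B)}\int_B|f(x)-f_B|dm_\lambda(x)$ and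 $f_B=\frac1{m_\lambda(B)}\int_Bf\,dm_\lambda$. *)

theory Defs
  imports "HOL-Analysis.Analysis" "HOL-Probability.Essential_Supremum"
begin

text \<open>
  The half line \<open>\<real>\<^sub>+ = (0, \<infinity>)\<close> is \<open>{0<..}\<close>. Functions on it are represented by total functions on
  \<open>real\<close> whose values outside \<open>{0<..}\<close> are irrelevant: all measures below live on \<open>{0<..}\<close>.
\<close>

definition power_measure :: "real \<Rightarrow> real measure" where
  "power_measure \<alpha> = density (lebesgue_on {0<..}) (\<lambda>x. ennreal (x powr \<alpha>))"

definition m_meas :: "real \<Rightarrow> real measure" where
  "m_meas lam = power_measure (2 * lam)"

definition nu_meas :: "real \<Rightarrow> real measure" where
  "nu_meas lam = power_measure (2 * lam + 1)"

definition L1_loc :: "real measure \<Rightarrow> (real \<Rightarrow> 'a::{banach, second_countable_topology}) set" where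
  "L1_loc M = {f. \<forall>K. compact K \<and> K \<subseteq> {0<..} \<longrightarrow> set_integrable M K f}"

definition average :: "real measure \<Rightarrow> (real \<Rightarrow> 'a) \<Rightarrow> real set \<Rightarrow> 'a::{banach, second_countable_topology}" where
  "average M f B = (1 / measure M B) *\<^sub>R (LINT t:B|M. f t)"

text \<open>
  The mean oscillation takes values in \<open>[0, \<infinity>]\<close>. If \<open>f\<close> is locally integrable but not integrable over
  \<open>B = (0, b)\<close>, the Bochner integral in \<open>average\<close> is \<open>0\<close> by convention, so the oscillation is a
  multiple of the integral of \<open>norm f\<close> over \<open>B\<close>, that is \<open>\<infinity>\<close>; hence finiteness
  below does entail integrability over every interval considered.
\<close>

definition mean_osc :: "real measure \<Rightarrow> (real \<Rightarrow> 'a::{banach, second_countable_topology}) \<Rightarrow> real set \<Rightarrow> ennreal" where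
  "mean_osc M f B = (\<integral>\<^sup>+ t\<in>B. ennreal (norm (f t - average M f B)) \<partial>M) / emeasure M B"

definition intervals :: "real set set" where
  "intervals = {{a<..<b} | a b. 0 \<le> a \<and> a < b}"

definition sharp_max :: "real \<Rightarrow> (real \<Rightarrow> 'a::{banach, second_countable_topology}) \<Rightarrow> real \<Rightarrow> ennreal" where
  "sharp_max lam f x = (SUP B\<in>{B \<in> intervals. x \<in> B}. mean_osc (nu_meas lam) f B)"

text \<open>
  \<open>esssup\<close> is \<open>\<infinity>\<close> on non-measurable functions, so its finiteness is membership in \<open>L\<^sup>\<infinity>\<close>. The measure
  \<open>nu_meas lam\<close> has the same null sets as Lebesgue measure on \<open>{0<..}\<close>.
\<close>

definition norm_BMO :: "real \<Rightarrow> (real \<Rightarrow> 'a::{banach, second_countable_topology}) \<Rightarrow> ennreal" where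
  "norm_BMO lam f = esssup (nu_meas lam) (sharp_max lam f)"

definition BMO :: "real \<Rightarrow> (real \<Rightarrow> 'a::{banach, second_countable_topology}) set" where
  "BMO lam = {f \<in> L1_loc (nu_meas lam). norm_BMO lam f < \<infinity>}"

definition norm_BMO_Delta :: "real \<Rightarrow> (real \<Rightarrow> 'a::{banach, second_countable_topology}) \<Rightarrow> ennreal" where
  "norm_BMO_Delta lam f = (SUP B\<in>intervals. mean_osc (m_meas lam) f B)"

definition BMO_Delta :: "real \<Rightarrow> (real \<Rightarrow> 'a::{banach, second_countable_topology}) set" where
  "BMO_Delta lam = {f \<in> L1_loc (m_meas lam). norm_BMO_Delta lam f < \<infinity>}"

end

theory Submission
  imports Defs
begin

text \<open>
  For any two exponents \<open>\<alpha>, \<beta> > -1\<close> the suprema of the mean oscillations with respect to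
  \<open>x\<^sup>\<alpha> dx\<close> and \<open>x\<^sup>\<beta> dx\<close> are comparable. On an interval \<open>(a, b)\<close> with \<open>b \<le> 2 a\<close> the two
  weights are proportional up to a bounded factor. Otherwise \<open>(a, b)\<close> may be enlarged to \<open>(0, b)\<close>.
  There, let \<open>c\<^sub>b\<close> be the \<open>\<alpha>\<close>-average over \<open>(0, b)\<close> and split at \<open>b / 2\<close>: the right half is
  controlled by the \<open>\<alpha>\<close>-oscillation, and on the left half the problem reproduces itself with the
  average over \<open>(0, b / 2)\<close> in place of \<open>c\<^sub>b\<close>, at the cost of a bounded multiple of the
  \<open>\<alpha>\<close>-oscillation, but with total \<open>\<beta>\<close>-mass smaller by the factor \<open>q = 2 powr - (\<beta> + 1) < 1\<close>.
  Cutting off at \<open>b / 2 ^ n\<close> makes this an induction on \<open>n\<close> with a bound independent of \<open>n\<close>, and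
  monotone convergence concludes.
\<close>

section \<open>Oscillation about an arbitrary centre, for a general measure\<close>

text \<open>Left unnormalised and with a free centre \<open>c\<close>, so that the set, the centre
  and the measure can be changed one at a time.\<close>

definition deviation :: "real measure \<Rightarrow> (real \<Rightarrow> 'a::{banach, second_countable_topology}) \<Rightarrow> 'a \<Rightarrow> real set \<Rightarrow> ennreal" where
  "deviation M f c B = (\<integral>\<^sup>+ t\<in>B. ennreal (norm (f t - c)) \<partial>M)"

lemma mean_osc_eq_deviation: "mean_osc M f B = deviation M f (average M f B) B / emeasure M B"
  by (simp add: mean_osc_def deviation_def)

lemma deviation_mono: "A \<subseteq> B \<Longrightarrow> deviation M f c A \<le> deviation M f c B"
  unfolding deviation_def by (intro nn_integral_mono mult_left_mono) (auto split: split_indicator)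

lemma deviation_triangle:
  assumes [measurable]: "f \<in> borel_measurable M" "B \<in> sets M"
  shows "deviation M f c B \<le> deviation M f d B + ennreal (norm (d - c)) * emeasure M B"
proof -
  have "deviation M f c B \<le> (\<integral>\<^sup>+ t. ennreal (norm (f t - d)) * indicator B t
      + ennreal (norm (d - c)) * indicator B t \<partial>M)"
    unfolding deviation_def
  proof (intro nn_integral_mono)
    fix t
    have "norm (f t - c) \<le> norm (f t - d) + norm (d - c)"
      using norm_triangle_ineq[of "f t - d" "d - c"] by simp
    then show "ennreal (norm (f t - c)) * indicator B t
      \<le> ennreal (norm (f t - d)) * indicator B t + ennreal (norm (d - c)) * indicator B t"
      by (auto split: split_indicator simp: ennreal_plus[symmetric] simp del: ennreal_plus intro!: ennreal_leI)
  qed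
  also have "\<dots> = deviation M f d B + ennreal (norm (d - c)) * emeasure M B"
    unfolding deviation_def by (subst nn_integral_add) (auto simp: nn_integral_cmult_indicator)
  finally show ?thesis .
qed

text \<open>Jensen's inequality: \<open>average M f B - c\<close> is the average of
  \<open>f - c\<close>, whose norm is at most the average of \<open>norm (f t - c)\<close>.\<close>

lemma norm_average_diff_le:
  assumes [measurable]: "f \<in> borel_measurable M" "B \<in> sets M"
    and B: "emeasure M B \<noteq> 0" "emeasure M B < \<infinity>"
  shows "ennreal (norm (average M f B - c)) * emeasure M B \<le> deviation M f c B"
\<comment> \<open>An infinite deviation makes the bound trivial. A finite one makes
  \<open>f - c\<close>, and hence \<open>f\<close>, integrable over \<open>B\<close>, so that the
  Bochner integral in \<open>average\<close> is not a default value.\<close>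
proof (cases "deviation M f c B = \<infinity>")
  case False
  have m: "emeasure M B = ennreal (measure M B)"
    using B by (intro emeasure_eq_ennreal_measure) auto
  then have m_pos: "measure M B > 0"
    using B by (auto simp: zero_less_measure_iff)
  have I: "set_integrable M B (\<lambda>t. f t - c)"
    unfolding set_integrable_def
  proof (rule integrableI_bounded)
    have "(\<integral>\<^sup>+ x. ennreal (norm (indicat_real B x *\<^sub>R (f x - c))) \<partial>M) = deviation M f c B"
      unfolding deviation_def by (intro nn_integral_cong) (auto split: split_indicator)
    then show "(\<integral>\<^sup>+ x. ennreal (norm (indicat_real B x *\<^sub>R (f x - c))) \<partial>M) < \<infinity>"
      using False by (simp add: less_top)
  qed simp
  have C: "set_integrable M B (\<lambda>t. c)"
    unfolding set_integrable_def using B by (intro integrable_scaleR_left) auto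
  have F: "set_integrable M B f"
    using set_integral_add(1)[OF I C] by simp
  have "(LINT t:B|M. f t - c) = (LINT t:B|M. f t) - measure M B *\<^sub>R c"
    using set_integral_diff(2)[OF F C] B by (simp add: set_integral_const)
  then have "average M f B - c = (1 / measure M B) *\<^sub>R (LINT t:B|M. f t - c)"
    using m_pos by (simp add: average_def scaleR_diff_right)
  then have "ennreal (norm (average M f B - c)) * emeasure M B = ennreal (norm (LINT t:B|M. f t - c))"
    using m m_pos by (simp add: ennreal_mult'[symmetric])
  also have "\<dots> \<le> (\<integral>\<^sup>+ x. ennreal (norm (indicat_real B x *\<^sub>R (f x - c))) \<partial>M)"
    unfolding set_lebesgue_integral_def
    by (rule integral_norm_bound_ennreal) (use I in \<open>simp add: set_integrable_def\<close>)
  also have "\<dots> = deviation M f c B"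
    unfolding deviation_def by (intro nn_integral_cong) (auto split: split_indicator)
  finally show ?thesis .
qed auto

text \<open>Any centre serves as well as the average up to a factor 2: by the triangle inequality,
  recentring at the average costs at most the deviation about \<open>c\<close> once more.\<close>

lemma mean_osc_le:
  assumes f: "f \<in> borel_measurable M" and B: "B \<in> sets M"
    and e: "emeasure M B \<noteq> 0" "emeasure M B < \<infinity>"
    and D: "deviation M f c B \<le> r * emeasure M B"
  shows "mean_osc M f B \<le> 2 * r"
proof -
  have "deviation M f (average M f B) B
      \<le> deviation M f c B + ennreal (norm (average M f B - c)) * emeasure M B"
    using deviation_triangle[OF f B, of "average M f B" c] by (simp add: norm_minus_commute)
  also have "\<dots> \<le> deviation M f c B + deviation M f c B"
    by (intro add_left_mono norm_average_diff_le f B e)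
  also have "\<dots> \<le> (2 * r) * emeasure M B"
    using add_mono[OF D D] by (simp add: mult_2 distrib_right)
  finally show ?thesis
    unfolding mean_osc_eq_deviation using e
    by (intro divide_le_posI_ennreal) (auto simp: zero_less_iff_neq_zero mult.commute)
qed

lemma deviation_average_le:
  assumes e: "emeasure M B \<noteq> 0" "emeasure M B < \<infinity>" and D: "mean_osc M f B \<le> r"
  shows "deviation M f (average M f B) B \<le> r * emeasure M B"
proof -
  have "deviation M f (average M f B) B = mean_osc M f B * emeasure M B"
    unfolding mean_osc_eq_deviation using e by (simp add: ennreal_divide_times ennreal_divide_self)
  then show ?thesis using D by (simp add: mult_right_mono)
qed

section \<open>Power weights\<close>

lemma sets_power_measure: "sets (power_measure \<alpha>) = sets (lebesgue_on {0<..})"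
  by (simp add: power_measure_def)

lemma space_power_measure [simp]: "space (power_measure \<alpha>) = {0<..}"
  by (simp add: power_measure_def)

lemma measurable_power_measure:
  "borel_measurable (power_measure \<alpha>) = borel_measurable (lebesgue_on {0<..})"
  by (rule measurable_cong_sets) (simp_all add: sets_power_measure)

lemma sets_power_measureI: "B \<in> sets borel \<Longrightarrow> B \<subseteq> {0<..} \<Longrightarrow> B \<in> sets (power_measure \<alpha>)"
  by (auto simp: sets_power_measure sets_restrict_space_iff)

lemma powr_measurable [measurable]: "(\<lambda>x. x powr \<alpha>) \<in> borel_measurable (lebesgue_on {0::real<..})"
  by (rule measurable_restrict_space1) (simp add: measurable_completion)

lemma emeasure_power_measure_from_0:
  assumes "\<alpha> > -1" "b \<ge> 0" and A: "A = {0<..b} \<or> A = {0<..<b}"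
  shows "emeasure (power_measure \<alpha>) A = ennreal (b powr (\<alpha> + 1) / (\<alpha> + 1))"
proof -
  have "((\<lambda>x. x powr \<alpha>) has_integral (b powr (\<alpha> + 1) / (\<alpha> + 1))) {0..b}"
    by (rule has_integral_powr_from_0) (use assms in auto)
  moreover have "negligible (sym_diff {0..b} A)"
    by (rule negligible_subset[of "{0,b}"]) (use A in auto)
  ultimately have I: "((\<lambda>x. x powr \<alpha>) has_integral (b powr (\<alpha> + 1) / (\<alpha> + 1))) A"
    by (subst has_integral_spike_set_eq[of A "{0..b}"]) (auto elim: negligible_subset)
  have [measurable]: "A \<in> sets borel" using A by auto
  have "A \<in> sets (lebesgue_on {0<..})" using A by (auto simp: sets_restrict_space_iff)
  then have "emeasure (power_measure \<alpha>) A
      = (\<integral>\<^sup>+ x. ennreal (x powr \<alpha>) * indicator A x \<partial>lebesgue_on {0<..})"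
    unfolding power_measure_def by (subst emeasure_density) auto
  also have "\<dots> = (\<integral>\<^sup>+ x. ennreal (x powr \<alpha>) * indicator A x \<partial>lborel)"
    using A by (subst nn_integral_restrict_space)
      (auto simp: nn_integral_completion intro!: nn_integral_cong split: split_indicator)
  also have "\<dots> = ennreal (b powr (\<alpha> + 1) / (\<alpha> + 1))"
    by (rule nn_integral_has_integral_lebesgue'[OF _ I]) auto
  finally show ?thesis .
qed

lemma emeasure_power_measure:
  assumes "\<alpha> > -1" "0 \<le> a" "a < b"
  shows "emeasure (power_measure \<alpha>) {a<..<b} = ennreal ((b powr (\<alpha> + 1) - a powr (\<alpha> + 1)) / (\<alpha> + 1))"
proof -
  have "{a<..<b} = {0<..<b} - {0<..a}" using assms by auto
  moreover have "emeasure (power_measure \<alpha>) ({0<..<b} - {0<..a})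
     = emeasure (power_measure \<alpha>) {0<..<b} - emeasure (power_measure \<alpha>) {0<..a}"
  proof (rule emeasure_Diff)
    show "emeasure (power_measure \<alpha>) {0<..a} \<noteq> \<infinity>"
      using emeasure_power_measure_from_0[of \<alpha> a "{0<..a}"] assms by simp
  qed (use assms in \<open>auto intro!: sets_power_measureI\<close>)
  ultimately have "emeasure (power_measure \<alpha>) {a<..<b}
     = emeasure (power_measure \<alpha>) {0<..<b} - emeasure (power_measure \<alpha>) {0<..a}"
    by metis
  also have "\<dots> = ennreal (b powr (\<alpha> + 1) / (\<alpha> + 1) - a powr (\<alpha> + 1) / (\<alpha> + 1))"
    using assms by (simp add: emeasure_power_measure_from_0[where b = b] emeasure_power_measure_from_0[where b = a] ennreal_minus)
  finally show ?thesis by (simp add: diff_divide_distrib)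
qed

lemma emeasure_power_measure_interval:
  assumes "\<alpha> > -1" "0 \<le> a" "a < b"
  shows "emeasure (power_measure \<alpha>) {a<..<b} \<noteq> 0" "emeasure (power_measure \<alpha>) {a<..<b} < \<infinity>"
proof -
  have "a powr (\<alpha> + 1) < b powr (\<alpha> + 1)"
    using assms by (intro powr_less_mono2) auto
  then show "emeasure (power_measure \<alpha>) {a<..<b} \<noteq> 0" "emeasure (power_measure \<alpha>) {a<..<b} < \<infinity>"
    using assms by (auto simp: emeasure_power_measure)
qed

section \<open>Comparison of two power weights where their quotient is bounded\<close>

lemma nn_integral_power_measure_le:
  assumes g: "g \<in> borel_measurable (lebesgue_on {0<..})"
    and B: "B \<in> sets borel" "B \<subseteq> {0<..}"
    and C: "C \<ge> 0" "\<And>x. x \<in> B \<Longrightarrow> x powr \<beta> \<le> C * x powr \<alpha>"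
  shows "(\<integral>\<^sup>+x\<in>B. g x \<partial>power_measure \<beta>) \<le> ennreal C * (\<integral>\<^sup>+x\<in>B. g x \<partial>power_measure \<alpha>)"
proof -
  note [measurable] = g
  have [measurable]: "B \<in> sets (lebesgue_on {0<..})"
    using B by (auto simp: sets_restrict_space_iff)
  have "(\<integral>\<^sup>+x\<in>B. g x \<partial>power_measure \<beta>)
      = (\<integral>\<^sup>+x. ennreal (x powr \<beta>) * (g x * indicator B x) \<partial>lebesgue_on {0<..})"
    unfolding power_measure_def by (rule nn_integral_density) auto
  also have "\<dots> \<le> (\<integral>\<^sup>+x. ennreal C * (ennreal (x powr \<alpha>) * (g x * indicator B x)) \<partial>lebesgue_on {0<..})"
  proof (intro nn_integral_mono)
    fix x
    have "ennreal (x powr \<beta>) * g x \<le> ennreal (C * x powr \<alpha>) * g x" if "x \<in> B"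
      by (intro mult_right_mono ennreal_leI C that) simp
    then show "ennreal (x powr \<beta>) * (g x * indicator B x)
       \<le> ennreal C * (ennreal (x powr \<alpha>) * (g x * indicator B x))"
      using C(1) by (cases "x \<in> B") (simp_all add: ennreal_mult mult.assoc)
  qed
  also have "\<dots> = ennreal C * (\<integral>\<^sup>+x. ennreal (x powr \<alpha>) * (g x * indicator B x) \<partial>lebesgue_on {0<..})"
    by (rule nn_integral_cmult) auto
  also have "(\<integral>\<^sup>+x. ennreal (x powr \<alpha>) * (g x * indicator B x) \<partial>lebesgue_on {0<..})
     = (\<integral>\<^sup>+x\<in>B. g x \<partial>power_measure \<alpha>)"
    unfolding power_measure_def by (rule nn_integral_density[symmetric]) auto
  finally show ?thesis .
qed

text \<open>The quotient \<open>x powr (\<beta> - \<alpha>)\<close> is monotone in \<open>x\<close>.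
  If \<beta> \<ge> \<alpha> it is at most its value at \<open>b\<close>, otherwise at most its value
  at \<open>b / 2\<close>, which produces the power of 2.\<close>

lemma powr_comparison:
  fixes x :: real
  assumes "b / 2 \<le> x" "x < b" "0 < b"
  shows "x powr \<beta> \<le> (2 powr \<bar>\<beta> - \<alpha>\<bar> * b powr (\<beta> - \<alpha>)) * x powr \<alpha>"
proof -
  have x: "x > 0" using assms by auto
  have "x powr (\<beta> - \<alpha>) \<le> 2 powr \<bar>\<beta> - \<alpha>\<bar> * b powr (\<beta> - \<alpha>)"
  proof (cases "\<beta> \<ge> \<alpha>")
    case True
    have "x powr (\<beta> - \<alpha>) \<le> 1 * b powr (\<beta> - \<alpha>)"
      using True assms x by (simp add: powr_mono2)
    also have "\<dots> \<le> 2 powr \<bar>\<beta> - \<alpha>\<bar> * b powr (\<beta> - \<alpha>)"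
      by (intro mult_right_mono) (auto simp: ge_one_powr_ge_zero)
    finally show ?thesis .
  next
    case False
    have "x powr (\<beta> - \<alpha>) \<le> (b / 2) powr (\<beta> - \<alpha>)"
      using False assms x by (intro powr_mono2') auto
    also have "\<dots> = 2 powr \<bar>\<beta> - \<alpha>\<bar> * b powr (\<beta> - \<alpha>)"
      using False assms by (simp add: powr_divide powr_minus_divide[symmetric] powr_diff field_simps)
    finally show ?thesis .
  qed
  then have "x powr (\<beta> - \<alpha>) * x powr \<alpha> \<le> (2 powr \<bar>\<beta> - \<alpha>\<bar> * b powr (\<beta> - \<alpha>)) * x powr \<alpha>"
    by (intro mult_right_mono) auto
  then show ?thesis using x by (simp add: powr_add[symmetric])
qed

lemma deviation_power_measure_le:
  assumes f: "f \<in> borel_measurable (lebesgue_on {0<..})" and "0 < b" "B \<in> sets borel" "B \<subseteq> {b/2..<b}"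
  shows "deviation (power_measure \<beta>) f c B
    \<le> ennreal (2 powr \<bar>\<beta> - \<alpha>\<bar> * b powr (\<beta> - \<alpha>)) * deviation (power_measure \<alpha>) f c B"
  unfolding deviation_def
proof (rule nn_integral_power_measure_le)
  show "(\<lambda>t. ennreal (norm (f t - c))) \<in> borel_measurable (lebesgue_on {0<..})"
    using f by measurable
  show "x powr \<beta> \<le> 2 powr \<bar>\<beta> - \<alpha>\<bar> * b powr (\<beta> - \<alpha>) * x powr \<alpha>" if "x \<in> B" for x
    using that assms by (intro powr_comparison) auto
qed (use assms in force)+

lemma emeasure_power_measure_le:
  assumes "0 < b" "B \<in> sets borel" "B \<subseteq> {b/2..<b}"
  shows "emeasure (power_measure \<beta>) B
    \<le> ennreal (2 powr \<bar>\<beta> - \<alpha>\<bar> * b powr (\<beta> - \<alpha>)) * emeasure (power_measure \<alpha>) B"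
proof -
  have "B \<subseteq> {0<..}" using assms by force
  then have "B \<in> sets (power_measure \<alpha>)" "B \<in> sets (power_measure \<beta>)"
    using assms by (auto intro: sets_power_measureI)
  moreover have "(\<integral>\<^sup>+x\<in>B. 1 \<partial>power_measure \<beta>)
    \<le> ennreal (2 powr \<bar>\<beta> - \<alpha>\<bar> * b powr (\<beta> - \<alpha>)) * (\<integral>\<^sup>+x\<in>B. 1 \<partial>power_measure \<alpha>)"
    by (rule nn_integral_power_measure_le) (use assms \<open>B \<subseteq> {0<..}\<close> powr_comparison[of b _ \<beta> \<alpha>] in auto)
  ultimately show ?thesis by simp
qed

section \<open>Comparison of oscillations for two power weights\<close>

lemma powr_half: "b > 0 \<Longrightarrow> (b / 2) powr (\<gamma> + 1) = 2 powr - (\<gamma> + 1) * b powr (\<gamma> + 1)" for b \<gamma> :: real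
  by (simp only: powr_minus_divide) (simp add: powr_divide)

text \<open>\<open>K\<close> is the fixed point of \<open>K = D + q (K + A)\<close>, the recursion in the induction step.\<close>
lemma deviation_dyadic:
  fixes f :: "real \<Rightarrow> 'a::{banach, second_countable_topology}"
  assumes \<alpha>: "\<alpha> > -1" and \<beta>: "\<beta> > -1" and f: "f \<in> borel_measurable (lebesgue_on {0<..})"
    and r: "0 \<le> r" "\<And>b. 0 < b \<Longrightarrow> mean_osc (power_measure \<alpha>) f {0<..<b} \<le> ennreal r"
    and D: "D = 2 powr \<bar>\<beta> - \<alpha>\<bar> * (\<beta> + 1) / (\<alpha> + 1)" and A: "A = 2 powr (\<alpha> + 1)"
    and q: "q = 2 powr - (\<beta> + 1)" and K: "K = (D + q * A) / (1 - q)"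
    and "0 < b"
  shows "deviation (power_measure \<beta>) f (average (power_measure \<alpha>) f {0<..<b}) {b / 2 ^ n<..<b}
    \<le> ennreal (K * r * (b powr (\<beta> + 1) / (\<beta> + 1)))"
  using \<open>0 < b\<close>
\<comment> \<open>The claim for \<open>Suc n\<close> at \<open>b\<close> rests on the claim for
  \<open>n\<close> at \<open>b / 2\<close>, which has the same cutoff point. For
  \<open>n = 0\<close> the interval is empty.\<close>
proof (induction n arbitrary: b)
  case 0
  then show ?case by (simp add: deviation_def)
next
  case (Suc n)
  note b = \<open>0 < b\<close>
  define c where "c b = average (power_measure \<alpha>) f {0<..<b}" for b
  \<comment> \<open>The \<beta>-mass of \<open>{0<..<b}\<close>; by \<open>powr_half\<close> that of
    \<open>{0<..<b/2}\<close> is \<open>q * w\<close>.\<close>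
  define w where "w = b powr (\<beta> + 1) / (\<beta> + 1)"
  have w: "w > 0" using \<beta> b by (simp add: w_def)
  have q1: "0 < q" "q < 1" using \<beta> by (auto simp: q powr_less_one)
  have D0: "D \<ge> 0" using \<alpha> \<beta> by (simp add: D)
  have fm: "f \<in> borel_measurable (power_measure \<gamma>)" for \<gamma>
    using f by (simp add: measurable_power_measure)
  have s: "{x<..<y} \<in> sets (power_measure \<gamma>)" "{x..<y} \<in> sets (power_measure \<gamma>)"
    if "0 < x" for x y \<gamma> using that by (auto intro!: sets_power_measureI)
  have s0: "{0<..<y} \<in> sets (power_measure \<gamma>)" for y \<gamma> by (auto intro!: sets_power_measureI)
  have dev: "deviation (power_measure \<alpha>) f (c b) {0<..<b} \<le> ennreal (r * (b powr (\<alpha> + 1) / (\<alpha> + 1)))" if "b > 0" for b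
  proof -
    have "deviation (power_measure \<alpha>) f (c b) {0<..<b} \<le> ennreal r * emeasure (power_measure \<alpha>) {0<..<b}"
      unfolding c_def by (intro deviation_average_le emeasure_power_measure_interval r that \<alpha>) simp_all
    then show ?thesis using that \<alpha> r by (simp add: emeasure_power_measure ennreal_mult[symmetric])
  qed
  \<comment> \<open>Averages over consecutive dyadic intervals differ little: apply Jensen on
    \<open>{0<..<b/2}\<close> with centre \<open>c b\<close>, then enlarge the domain to
    \<open>{0<..<b}\<close>. The constant \<open>A\<close> is the ratio of the \<alpha>-masses of
    these two intervals.\<close>
  have ndiff: "norm (c (b/2) - c b) \<le> A * r"
  proof -
    have "ennreal (norm (c (b/2) - c b)) * emeasure (power_measure \<alpha>) {0<..<b/2}
        \<le> deviation (power_measure \<alpha>) f (c b) {0<..<b/2}"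
      unfolding c_def using b by (intro norm_average_diff_le fm s0 emeasure_power_measure_interval \<alpha>) auto
    also have "\<dots> \<le> deviation (power_measure \<alpha>) f (c b) {0<..<b}"
      using b by (intro deviation_mono) auto
    also have "\<dots> \<le> ennreal (r * (b powr (\<alpha> + 1) / (\<alpha> + 1)))" by (rule dev[OF b])
    finally have "norm (c (b/2) - c b) * ((b/2) powr (\<alpha> + 1) / (\<alpha> + 1)) \<le> r * (b powr (\<alpha> + 1) / (\<alpha> + 1))"
      using b \<alpha> r by (simp add: emeasure_power_measure ennreal_mult[symmetric] del: times_divide_eq_right)
    then have "norm (c (b/2) - c b) * (b/2) powr (\<alpha> + 1) / (\<alpha> + 1) \<le> r * b powr (\<alpha> + 1) / (\<alpha> + 1)"
      by simp
    then have "norm (c (b/2) - c b) * (b/2) powr (\<alpha> + 1) \<le> r * b powr (\<alpha> + 1)"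
      using \<alpha> by (subst (asm) divide_le_cancel) auto
    then have "(norm (c (b/2) - c b) * 2 powr - (\<alpha> + 1)) * b powr (\<alpha> + 1) \<le> r * b powr (\<alpha> + 1)"
      by (simp only: powr_half[OF b] mult.assoc)
    then have "norm (c (b/2) - c b) * 2 powr - (\<alpha> + 1) \<le> r"
      using b by simp
    then show ?thesis
      unfolding A powr_minus_divide by (simp add: pos_divide_le_eq mult.commute del: minus_add_distrib)
  qed
  \<comment> \<open>\<open>?J\<close> is treated by recentring at \<open>c (b/2)\<close> and the
    induction hypothesis, \<open>?L\<close> by comparing the two weights on one dyadic
    block.\<close>
  let ?I = "{b / 2 ^ Suc n<..<b}" and ?J = "{b / 2 / 2 ^ n<..<b/2}" and ?L = "{b/2..<b}"
  let ?dev = "deviation (power_measure \<beta>) f"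
  have "?dev (c b) ?I \<le> ?dev (c b) (?J \<union> ?L)"
    by (intro deviation_mono) (auto simp: field_simps)
  also have "\<dots> \<le> ?dev (c b) ?J + ?dev (c b) ?L"
    unfolding deviation_def using b fm s
    by (subst nn_integral_disjoint_pair[symmetric]) (auto)
  also have "\<dots> \<le> ennreal ((K * r + A * r) * (q * w)) + ennreal (D * r * w)"
  proof (rule add_mono)
    have "?dev (c b) ?J \<le> ?dev (c (b/2)) ?J + ennreal (norm (c (b/2) - c b)) * emeasure (power_measure \<beta>) ?J"
      using b by (intro deviation_triangle fm s) auto
    also have "\<dots> \<le> ennreal (K * r * (q * w)) + ennreal (A * r) * ennreal (q * w)"
    proof (intro add_mono mult_mono)
      show "?dev (c (b/2)) ?J \<le> ennreal (K * r * (q * w))"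
        using Suc.IH[of "b/2"] b by (simp add: c_def w_def powr_half q)
      have "emeasure (power_measure \<beta>) ?J \<le> emeasure (power_measure \<beta>) {0<..<b/2}"
        using b by (intro emeasure_mono s0) (simp add: greaterThanLessThan_subseteq_greaterThanLessThan)
      then show "emeasure (power_measure \<beta>) ?J \<le> ennreal (q * w)"
        using b \<beta> by (simp add: emeasure_power_measure w_def powr_half q)
    qed (use ndiff in \<open>auto intro: ennreal_leI\<close>)
    also have "\<dots> = ennreal ((K * r + A * r) * (q * w))"
      using q1 D0 w r by (simp add: ennreal_mult[symmetric] ennreal_plus[symmetric] A K algebra_simps del: ennreal_plus)
    finally show "?dev (c b) ?J \<le> ennreal ((K * r + A * r) * (q * w))" .
  next
    have "?dev (c b) ?L \<le> ennreal (2 powr \<bar>\<beta> - \<alpha>\<bar> * b powr (\<beta> - \<alpha>)) * deviation (power_measure \<alpha>) f (c b) ?L"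
      using b by (intro deviation_power_measure_le f) auto
    also have "\<dots> \<le> ennreal (2 powr \<bar>\<beta> - \<alpha>\<bar> * b powr (\<beta> - \<alpha>)) * deviation (power_measure \<alpha>) f (c b) {0<..<b}"
      using b by (intro mult_left_mono deviation_mono) auto
    also have "\<dots> \<le> ennreal (2 powr \<bar>\<beta> - \<alpha>\<bar> * b powr (\<beta> - \<alpha>)) * ennreal (r * (b powr (\<alpha> + 1) / (\<alpha> + 1)))"
      by (intro mult_left_mono dev b) auto
    also have "\<dots> = ennreal (2 powr \<bar>\<beta> - \<alpha>\<bar> * r * (b powr (\<beta> - \<alpha>) * b powr (\<alpha> + 1)) / (\<alpha> + 1))"
      using \<alpha> r by (simp add: ennreal_mult[symmetric] mult_ac)
    \<comment> \<open>The exponents add up to \<open>\<beta> + 1\<close>; replacing the denominator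
      \<open>\<alpha> + 1\<close> by the \<open>\<beta> + 1\<close> of \<open>w\<close> gives the
      quotient in \<open>D\<close>.\<close>
    also have "\<dots> = ennreal (D * r * w)"
      using \<alpha> \<beta> by (simp add: powr_add[symmetric] D w_def mult_ac)
    finally show "?dev (c b) ?L \<le> ennreal (D * r * w)" .
  qed
  also have "\<dots> = ennreal ((D + q * (K + A)) * r * w)"
    using q1 D0 w r by (simp add: ennreal_plus[symmetric] A K algebra_simps del: ennreal_plus)
  also have "D + q * (K + A) = K"
    using q1 by (simp add: K field_simps)
  finally show ?case by (simp add: c_def w_def)
qed

text \<open>The intervals \<open>{b / 2 ^ n<..<b}\<close> increase to \<open>{0<..<b}\<close>, so
  monotone convergence carries over a bound uniform in \<open>n\<close>. The centre \<open>c\<close>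
  stays fixed, and integrability of \<open>f\<close> near 0 is not presupposed.\<close>

lemma deviation_Ioo0_le:
  assumes f: "f \<in> borel_measurable (power_measure \<beta>)" and b: "0 < b"
    and le: "\<And>n. deviation (power_measure \<beta>) f c {b / 2 ^ n<..<b} \<le> r"
  shows "deviation (power_measure \<beta>) f c {0<..<b} \<le> r"
proof -
  define g where "g n t = ennreal (norm (f t - c)) * indicator {b / 2 ^ n<..<b} t" for n :: nat and t
  have g: "g n \<in> borel_measurable (power_measure \<beta>)" for n
    unfolding g_def using b f
    by (intro borel_measurable_times_ennreal borel_measurable_indicator sets_power_measureI) (auto intro: less_trans[rotated])
  have "incseq (\<lambda>n. {b / 2 ^ n<..<b})"
    using b by (intro incseq_SucI) (auto simp: field_simps)
  then have inc: "incseq g"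
    unfolding g_def incseq_def le_fun_def
    by (auto simp: subset_iff intro!: mult_left_mono indicator_leI)
  have "(SUP n. g n t) = ennreal (norm (f t - c)) * indicator {0<..<b} t" for t
  proof (cases "t \<in> {0<..<b}")
    case True
    \<comment> \<open>From this \<open>n\<close> on, \<open>t\<close> lies in the truncated
      interval, so the supremum is attained.\<close>
    then obtain n where "(1/2) ^ n < t / b"
      using real_arch_pow_inv[of "t / b" "1/2"] b by auto
    then have "b / 2 ^ n < t" using b by (simp add: field_simps power_divide)
    then have "g n t = ennreal (norm (f t - c))" using True by (simp add: g_def)
    moreover have "g m t \<le> ennreal (norm (f t - c))" for m by (simp add: g_def split: split_indicator)
    ultimately show ?thesis
      using True by (intro antisym SUP_least) (auto intro: SUP_upper2[of n])
  next
    case False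
    then have "g n t = 0" for n using b by (auto simp: g_def split: split_indicator elim: notE intro: less_trans[rotated])
    then show ?thesis using False by simp
  qed
  then have "deviation (power_measure \<beta>) f c {0<..<b} = (\<integral>\<^sup>+ t. (SUP n. g n t) \<partial>power_measure \<beta>)"
    by (simp add: deviation_def)
  also have "\<dots> = (SUP n. integral\<^sup>N (power_measure \<beta>) (g n))"
    by (rule nn_integral_monotone_convergence_SUP[OF inc g])
  also have "\<dots> \<le> r"
    using le by (intro SUP_least) (simp add: deviation_def g_def[abs_def])
  finally show ?thesis .
qed

text \<open>For each interval it suffices to find some centre with small \<beta>-deviation;
  \<open>mean_osc_le\<close> then supplies the average at the cost of a factor 2. The constant is
  chosen before \<open>f\<close> and \<open>r\<close>.\<close>

lemma mean_osc_power_measure_le: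
  assumes \<alpha>: "\<alpha> > -1" and \<beta>: "\<beta> > -1"
  shows "\<exists>C>0. \<forall>(f :: real \<Rightarrow> 'a::{banach, second_countable_topology}) \<in> borel_measurable (lebesgue_on {0<..}). \<forall>r\<ge>0.
    (\<forall>B\<in>intervals. mean_osc (power_measure \<alpha>) f B \<le> ennreal r) \<longrightarrow>
    (\<forall>B\<in>intervals. mean_osc (power_measure \<beta>) f B \<le> ennreal (C * r))"
proof -
  define D where "D = 2 powr \<bar>\<beta> - \<alpha>\<bar> * (\<beta> + 1) / (\<alpha> + 1)"
  define A :: real where "A = 2 powr (\<alpha> + 1)"
  define q where "q = 2 powr - (\<beta> + 1)"
  define K where "K = (D + q * A) / (1 - q)"
  \<comment> \<open>The first entry serves intervals within one dyadic block, the second those with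
    \<open>a < b / 2\<close>.\<close>
  define C where "C = max (2 powr \<bar>\<beta> - \<alpha>\<bar> * 2 powr \<bar>\<alpha> - \<beta>\<bar>) (K / (1 - q))"
  have q1: "0 < q" "q < 1" using \<beta> by (auto simp: q_def powr_less_one)
  have "D \<ge> 0" using \<alpha> \<beta> by (simp add: D_def)
  then have K0: "K \<ge> 0" using q1 by (simp add: K_def A_def)
  have C0: "C > 0" by (auto simp: C_def less_max_iff_disj)
  have "mean_osc (power_measure \<beta>) f B \<le> ennreal (2 * C * r)"
    if f: "f \<in> borel_measurable (lebesgue_on {0<..})" and r: "r \<ge> 0"
      and osc: "\<And>B. B \<in> intervals \<Longrightarrow> mean_osc (power_measure \<alpha>) f B \<le> ennreal r" and B: "B \<in> intervals"
    for f :: "real \<Rightarrow> 'a" and r B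
  proof -
    obtain a b where ab: "B = {a<..<b}" "0 \<le> a" "a < b" using B by (auto simp: intervals_def)
    have b: "b > 0" using ab by simp
    have s: "B \<in> sets (power_measure \<gamma>)" for \<gamma> using ab by (auto intro!: sets_power_measureI)
    have fm: "f \<in> borel_measurable (power_measure \<beta>)"
      using f by (simp add: measurable_power_measure)
    have e: "emeasure (power_measure \<gamma>) B \<noteq> 0" "emeasure (power_measure \<gamma>) B < \<infinity>" if "\<gamma> > -1" for \<gamma>
      unfolding ab(1) using ab that by (intro emeasure_power_measure_interval; simp)+
    have "\<exists>c. deviation (power_measure \<beta>) f c B \<le> ennreal (C * r) * emeasure (power_measure \<beta>) B"
    \<comment> \<open>In the first case the weights are compared twice, once for the deviation and
      once to return from \<alpha>-mass to \<beta>-mass; the powers of \<open>b\<close>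
      cancel.\<close>
    proof (cases "b / 2 \<le> a")
      case True
      then have sub: "B \<subseteq> {b/2..<b}" "B \<in> sets borel" using ab by auto
      let ?c = "average (power_measure \<alpha>) f B"
      let ?s = "ennreal (2 powr \<bar>\<beta> - \<alpha>\<bar> * b powr (\<beta> - \<alpha>))" and ?t = "ennreal (2 powr \<bar>\<alpha> - \<beta>\<bar> * b powr (\<alpha> - \<beta>))"
      have "deviation (power_measure \<beta>) f ?c B \<le> ?s * deviation (power_measure \<alpha>) f ?c B"
        by (rule deviation_power_measure_le[OF f b sub(2,1)])
      also have "\<dots> \<le> ?s * (ennreal r * emeasure (power_measure \<alpha>) B)"
        by (intro mult_left_mono deviation_average_le e osc B \<alpha>) simp
      also have "\<dots> \<le> ?s * (ennreal r * (?t * emeasure (power_measure \<beta>) B))"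
        by (intro mult_left_mono emeasure_power_measure_le b sub) simp_all
      also have "\<dots> = (?s * ennreal r * ?t) * emeasure (power_measure \<beta>) B"
        by (simp add: mult_ac)
      also have "?s * ennreal r * ?t = ennreal (2 powr \<bar>\<beta> - \<alpha>\<bar> * 2 powr \<bar>\<alpha> - \<beta>\<bar> * r * (b powr (\<beta> - \<alpha>) * b powr (\<alpha> - \<beta>)))"
        using r by (simp add: ennreal_mult[symmetric] mult_ac)
      also have "b powr (\<beta> - \<alpha>) * b powr (\<alpha> - \<beta>) = 1"
        using b by (simp add: powr_add[symmetric])
      also have "ennreal (2 powr \<bar>\<beta> - \<alpha>\<bar> * 2 powr \<bar>\<alpha> - \<beta>\<bar> * r * 1) \<le> ennreal (C * r)"
        using r by (intro ennreal_leI) (auto simp: C_def intro!: mult_right_mono)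
      finally show ?thesis by (auto simp: mult_right_mono)
    next
      case False
      let ?c = "average (power_measure \<alpha>) f {0<..<b}"
      define w where "w = b powr (\<beta> + 1) / (\<beta> + 1)"
      have w: "w > 0" using b \<beta> by (simp add: w_def)
      have "deviation (power_measure \<beta>) f ?c B \<le> deviation (power_measure \<beta>) f ?c {0<..<b}"
        using ab by (intro deviation_mono) auto
      also have "\<dots> \<le> ennreal (K * r * w)"
        unfolding w_def
      proof (rule deviation_Ioo0_le[OF fm])
        fix n
        show "deviation (power_measure \<beta>) f ?c {b / 2 ^ n<..<b} \<le> ennreal (K * r * (b powr (\<beta> + 1) / (\<beta> + 1)))"
          by (rule deviation_dyadic[OF \<alpha> \<beta> f r osc D_def A_def q_def K_def b])
            (auto simp: intervals_def)
      qed (rule b)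
      \<comment> \<open>\<open>(1 - q) * w\<close> is the \<beta>-mass of \<open>{b/2<..<b}\<close>,
        which lies in \<open>B\<close> because \<open>a < b / 2\<close>. Hence enlarging
        \<open>B\<close> to \<open>{0<..<b}\<close> costs at most the factor
        \<open>1 / (1 - q)\<close>.\<close>
      also have "\<dots> = ennreal (K / (1 - q) * r * ((1 - q) * w))"
        using q1 by (simp add: mult.assoc)
      also have "\<dots> \<le> ennreal (C * r * ((1 - q) * w))"
        using r w q1 by (intro ennreal_leI mult_right_mono) (auto simp: C_def)
      also have "\<dots> = ennreal (C * r) * ennreal ((1 - q) * w)"
        using C0 r w q1 by (intro ennreal_mult) auto
      also have "ennreal ((1 - q) * w) = emeasure (power_measure \<beta>) {b/2<..<b}"
        using b \<beta> by (simp add: emeasure_power_measure powr_half w_def q_def left_diff_distrib diff_divide_distrib)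
      also have "\<dots> \<le> emeasure (power_measure \<beta>) B"
        using ab False by (intro emeasure_mono s) auto
      finally show ?thesis by (auto simp: mult_left_mono)
    qed
    then obtain c where "deviation (power_measure \<beta>) f c B \<le> ennreal (C * r) * emeasure (power_measure \<beta>) B" ..
    then have "mean_osc (power_measure \<beta>) f B \<le> 2 * ennreal (C * r)"
      by (intro mean_osc_le fm s e \<beta>)
    then show ?thesis
      using C0 r by (simp add: ennreal_mult mult.assoc)
  qed
  then show ?thesis using C0 by (intro exI[of _ "2 * C"]) auto
qed

section \<open>Local integrability and the essential supremum\<close>

text \<open>On the half line \<open>f\<close> is the pointwise limit of its truncations to the
  compact sets \<open>K n\<close>, and each truncation is integrable, hence measurable.\<close>

lemma L1_loc_imp_measurable:
  assumes "f \<in> L1_loc (power_measure \<alpha>)"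
  shows "f \<in> borel_measurable (lebesgue_on {0<..})"
proof (rule borel_measurable_LIMSEQ_metric)
  define K where "K n = {1 / real (Suc n)..real (Suc n)}" for n
  show "(\<lambda>x. indicat_real (K n) x *\<^sub>R f x) \<in> borel_measurable (lebesgue_on {0<..})" for n
  proof -
    have "K n \<subseteq> {0<..}" by (auto simp: K_def intro: less_le_trans[rotated])
    then have "set_integrable (power_measure \<alpha>) (K n) f"
      using assms by (auto simp: L1_loc_def K_def)
    then show ?thesis
      by (auto simp: set_integrable_def measurable_power_measure dest!: borel_measurable_integrable)
  qed
  fix x :: real assume "x \<in> space (lebesgue_on {0<..})"
  then have x: "x > 0" by simp
  obtain N where N: "real N > max x (1 / x)" using reals_Archimedean2 by blast
  have "x \<in> K n" if "n \<ge> N" for n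
  proof -
    have "real (Suc n) > x" "real (Suc n) > 1 / x" using that N by auto
    then show ?thesis using x by (auto simp: K_def field_simps)
  qed
  then have "eventually (\<lambda>n. indicat_real (K n) x *\<^sub>R f x = f x) sequentially"
    unfolding eventually_sequentially by (intro exI[of _ N]) auto
  then show "(\<lambda>n. indicat_real (K n) x *\<^sub>R f x) \<longlonglongrightarrow> f x"
    by (rule tendsto_eventually)
qed

text \<open>On a compact subset of the open half line the quotient of the two weights is continuous,
  hence bounded.\<close>

lemma L1_loc_power_measure_mono: "L1_loc (power_measure \<alpha>) \<subseteq> L1_loc (power_measure \<beta>)"
proof
  fix f :: "real \<Rightarrow> 'a" assume f: "f \<in> L1_loc (power_measure \<alpha>)"
  note [measurable] = L1_loc_imp_measurable[OF f]
  show "f \<in> L1_loc (power_measure \<beta>)"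
    unfolding L1_loc_def
  proof safe
    fix K :: "real set" assume K: "compact K" "K \<subseteq> {0<..}"
    have Kb: "K \<in> sets borel" using K by (simp add: borel_compact)
    have "K \<in> sets (power_measure \<gamma>)" for \<gamma> by (intro sets_power_measureI Kb K)
    then have [measurable]: "K \<in> sets (lebesgue_on {0<..})" by (simp add: sets_power_measure)
    have "compact ((\<lambda>x. x powr (\<beta> - \<alpha>)) ` K)"
      using K by (intro compact_continuous_image continuous_intros) auto
    then obtain C where C: "\<And>x. x \<in> K \<Longrightarrow> x powr (\<beta> - \<alpha>) \<le> C"
      by (force dest!: compact_imp_bounded simp: bounded_iff)
    have eq: "(\<integral>\<^sup>+ x. ennreal (norm (indicat_real K x *\<^sub>R f x)) \<partial>power_measure \<gamma>)
        = (\<integral>\<^sup>+ x\<in>K. ennreal (norm (f x)) \<partial>power_measure \<gamma>)" for \<gamma>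
      by (intro nn_integral_cong) (auto split: split_indicator)
    \<comment> \<open>\<open>max 0 C\<close> covers an empty \<open>K\<close>, for which the bound
      \<open>C\<close> may be negative.\<close>
    have "(\<integral>\<^sup>+ x\<in>K. ennreal (norm (f x)) \<partial>power_measure \<beta>)
        \<le> ennreal (max 0 C) * (\<integral>\<^sup>+ x\<in>K. ennreal (norm (f x)) \<partial>power_measure \<alpha>)"
    proof (rule nn_integral_power_measure_le[OF _ Kb K(2)])
      fix x assume x: "x \<in> K"
      have "x powr (\<beta> - \<alpha>) * x powr \<alpha> \<le> max 0 C * x powr \<alpha>"
        using C[OF x] by (intro mult_right_mono) auto
      moreover have "x > 0" using x K by auto
      ultimately show "x powr \<beta> \<le> max 0 C * x powr \<alpha>" by (simp add: powr_add[symmetric])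
    qed auto
    also have "\<dots> < \<infinity>"
    proof -
      have "set_integrable (power_measure \<alpha>) K f" using f K by (auto simp: L1_loc_def)
      then show ?thesis
        unfolding set_integrable_def integrable_iff_bounded eq by (auto simp: ennreal_mult_less_top)
    qed
    finally show "set_integrable (power_measure \<beta>) K f"
      unfolding set_integrable_def integrable_iff_bounded eq by (auto simp: measurable_power_measure)
  qed
qed

lemma L1_loc_power_measure_eq: "L1_loc (power_measure \<alpha>) = L1_loc (power_measure \<beta>)"
  by (intro equalityI L1_loc_power_measure_mono)

text \<open>The maximal function is a supremum of functions that are constant on open intervals, hence lower
  semicontinuous; so its essential supremum is a genuine supremum.\<close>
lemma norm_BMO_eq_SUP:
  assumes lam: "lam > -1"
  shows "norm_BMO lam f = (SUP B\<in>intervals. mean_osc (nu_meas lam) f B)"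
proof (rule antisym)
  have P: "nu_meas lam = power_measure (2 * lam + 1)" by (simp add: nu_meas_def)
  \<comment> \<open>Measurability is what lets \<open>esssup\<close> be bounded by a pointwise
    bound. Each strict superlevel set is the union of the intervals whose oscillation exceeds
    \<open>y\<close>, so it is open.\<close>
  have "sharp_max lam f \<in> borel_measurable (nu_meas lam)"
  proof (rule borel_measurableI_greater)
    fix y
    have "{x \<in> space (nu_meas lam). y < sharp_max lam f x}
       = \<Union>{B \<in> intervals. y < mean_osc (nu_meas lam) f B}"
      by (auto simp: P sharp_max_def less_SUP_iff intervals_def)
    moreover have "open (\<Union>{B \<in> intervals. y < mean_osc (nu_meas lam) f B})"
      by (auto simp: intervals_def)
    moreover have "\<Union>{B \<in> intervals. y < mean_osc (nu_meas lam) f B} \<subseteq> {0<..}"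
      by (auto simp: intervals_def)
    ultimately show "{x \<in> space (nu_meas lam). y < sharp_max lam f x} \<in> sets (nu_meas lam)"
      by (simp add: P sets_power_measureI)
  qed
  then show "norm_BMO lam f \<le> (SUP B\<in>intervals. mean_osc (nu_meas lam) f B)"
    unfolding norm_BMO_def by (rule esssup_I) (auto simp: sharp_max_def intro!: SUP_subset_mono AE_I2)
  show "(SUP B\<in>intervals. mean_osc (nu_meas lam) f B) \<le> norm_BMO lam f"
  proof (rule SUP_least)
    fix B assume B: "B \<in> intervals"
    then obtain a b where ab: "B = {a<..<b}" "0 \<le> a" "a < b" by (auto simp: intervals_def)
    \<comment> \<open>The essential supremum bounds the maximal function almost everywhere, and
      \<open>B\<close> has positive measure, so the bound holds at some point of \<open>B\<close>.
      There the maximal function dominates the oscillation over \<open>B\<close>.\<close>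
    have "\<exists>x\<in>B. sharp_max lam f x \<le> norm_BMO lam f"
    proof (rule ccontr)
      assume "\<not> ?thesis"
      then have "AE x in nu_meas lam. x \<notin> B"
        using esssup_AE[of "sharp_max lam f" "nu_meas lam"] by (auto simp: norm_BMO_def)
      moreover have "B \<in> sets (nu_meas lam)"
        using ab by (auto simp: P intro!: sets_power_measureI)
      ultimately have "emeasure (nu_meas lam) B = 0"
        by (simp add: AE_iff_null_sets null_setsD1)
      then show False
        using emeasure_power_measure_interval(1)[of "2 * lam + 1" a b] ab lam by (simp add: P)
    qed
    then obtain x where "x \<in> B" "sharp_max lam f x \<le> norm_BMO lam f" ..
    moreover have "mean_osc (nu_meas lam) f B \<le> sharp_max lam f x"
      using B \<open>x \<in> B\<close> by (auto simp: sharp_max_def intro!: SUP_upper)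
    ultimately show "mean_osc (nu_meas lam) f B \<le> norm_BMO lam f" by simp
  qed
qed

section \<open>Equivalence of the norms and equality of the spaces\<close>

lemma SUP_mean_osc_power_measure_le:
  assumes "\<alpha> > -1" "\<beta> > -1"
  shows "\<exists>C>0. \<forall>(f :: real \<Rightarrow> 'a::{banach, second_countable_topology}) \<in> borel_measurable (lebesgue_on {0<..}).
    (SUP B\<in>intervals. mean_osc (power_measure \<beta>) f B)
    \<le> ennreal C * (SUP B\<in>intervals. mean_osc (power_measure \<alpha>) f B)"
proof -
  obtain C where C: "C > 0" "\<And>(f :: real \<Rightarrow> 'a) r B. f \<in> borel_measurable (lebesgue_on {0<..}) \<Longrightarrow> r \<ge> 0 \<Longrightarrow>
    (\<And>B. B\<in>intervals \<Longrightarrow> mean_osc (power_measure \<alpha>) f B \<le> ennreal r) \<Longrightarrow>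
    B\<in>intervals \<Longrightarrow> mean_osc (power_measure \<beta>) f B \<le> ennreal (C * r)"
    using mean_osc_power_measure_le[OF assms, where ?'a = 'a] by blast
  have "(SUP B\<in>intervals. mean_osc (power_measure \<beta>) f B) \<le> ennreal C * N"
    if f: "f \<in> borel_measurable (lebesgue_on {0<..})" and N: "N = (SUP B\<in>intervals. mean_osc (power_measure \<alpha>) f B)"
    for f :: "real \<Rightarrow> 'a" and N
  proof (cases N)
    case (real r)
    then have "mean_osc (power_measure \<alpha>) f B \<le> ennreal r" if "B \<in> intervals" for B
      unfolding real(2)[symmetric] by (subst N) (rule SUP_upper[OF that])
    then have "(SUP B\<in>intervals. mean_osc (power_measure \<beta>) f B) \<le> ennreal (C * r)"
      using C(2)[OF f] real by (intro SUP_least) auto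
    then show ?thesis using C(1) real by (simp add: ennreal_mult)
  \<comment> \<open>An infinite supremum is harmless because \<open>C > 0\<close>; in
    \<open>ennreal\<close> the product of 0 and \<infinity> would be 0.\<close>
  next
    case top
    then show ?thesis using C(1) by (simp add: ennreal_mult_top)
  qed
  then show ?thesis using C(1) by blast
qed

theorem proposition1p10:
  fixes lam :: real
  assumes "lam > - 1 / 2" and "lam \<noteq> 0"
  shows "(BMO_Delta lam :: (real \<Rightarrow> 'a::{real_normed_field, euclidean_space}) set) = BMO lam \<and>
    (\<exists>c C. 0 < c \<and> 0 < C \<and>
      (\<forall>f \<in> (BMO_Delta lam :: (real \<Rightarrow> 'a) set).
        ennreal c * norm_BMO lam f \<le> norm_BMO_Delta lam f \<and>
        norm_BMO_Delta lam f \<le> ennreal C * norm_BMO lam f))"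
proof -
  have lam: "2 * lam > -1" "2 * lam + 1 > -1" "lam > -1" using assms by auto
  \<comment> \<open>The comparison is used in both directions between the exponents
    \<open>2 * lam\<close> and \<open>2 * lam + 1\<close>: \<open>C1\<close> passes from
    \<open>m_meas\<close> to \<open>nu_meas\<close>, \<open>C2\<close> back.\<close>
  obtain C1 where C1: "C1 > 0" "\<And>f :: real \<Rightarrow> 'a. f \<in> borel_measurable (lebesgue_on {0<..}) \<Longrightarrow>
      norm_BMO lam f \<le> ennreal C1 * norm_BMO_Delta lam f"
    using SUP_mean_osc_power_measure_le[OF lam(1,2), where ?'a = 'a]
    by (auto simp: norm_BMO_eq_SUP[OF lam(3)] norm_BMO_Delta_def m_meas_def nu_meas_def)
  obtain C2 where C2: "C2 > 0" "\<And>f :: real \<Rightarrow> 'a. f \<in> borel_measurable (lebesgue_on {0<..}) \<Longrightarrow>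
      norm_BMO_Delta lam f \<le> ennreal C2 * norm_BMO lam f"
    using SUP_mean_osc_power_measure_le[OF lam(2,1), where ?'a = 'a]
    by (auto simp: norm_BMO_eq_SUP[OF lam(3)] norm_BMO_Delta_def m_meas_def nu_meas_def)
  have L: "L1_loc (m_meas lam) = (L1_loc (nu_meas lam) :: (real \<Rightarrow> 'a) set)"
    unfolding m_meas_def nu_meas_def by (rule L1_loc_power_measure_eq)
  have meas: "f \<in> borel_measurable (lebesgue_on {0<..})" if "f \<in> L1_loc (nu_meas lam)" for f :: "real \<Rightarrow> 'a"
    using that unfolding nu_meas_def by (rule L1_loc_imp_measurable)
  have "norm_BMO lam f < \<infinity> \<longleftrightarrow> norm_BMO_Delta lam f < \<infinity>" if "f \<in> L1_loc (nu_meas lam)" for f :: "real \<Rightarrow> 'a"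
    using C1(2)[OF meas[OF that]] C2(2)[OF meas[OF that]]
    by (auto simp: ennreal_mult_less_top elim: le_less_trans)
  then have "(BMO_Delta lam :: (real \<Rightarrow> 'a) set) = BMO lam"
    unfolding BMO_Delta_def BMO_def L by auto
  moreover have "ennreal (1 / C1) * norm_BMO lam f \<le> norm_BMO_Delta lam f \<and>
        norm_BMO_Delta lam f \<le> ennreal C2 * norm_BMO lam f" if "f \<in> BMO_Delta lam" for f :: "real \<Rightarrow> 'a"
  proof
    have f: "f \<in> borel_measurable (lebesgue_on {0<..})"
      using that meas L by (auto simp: BMO_Delta_def)
    \<comment> \<open>The lower constant comes from dividing the bound with \<open>C1\<close> by
      \<open>C1\<close>.\<close>
    have "ennreal (1 / C1) * norm_BMO lam f \<le> ennreal (1 / C1) * (ennreal C1 * norm_BMO_Delta lam f)"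
      by (intro mult_left_mono C1(2) f) simp
    also have "\<dots> = norm_BMO_Delta lam f"
      using C1(1) by (simp add: mult.assoc[symmetric] ennreal_mult[symmetric])
    finally show "ennreal (1 / C1) * norm_BMO lam f \<le> norm_BMO_Delta lam f" .
    show "norm_BMO_Delta lam f \<le> ennreal C2 * norm_BMO lam f" by (rule C2(2)[OF f])
  qed
  ultimately show ?thesis using C1(1) C2(1) by (intro conjI exI[of _ "1 / C1"] exI[of _ C2]) auto
qed

end
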